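(* Let $\lambda>0$, $\mu\in(0,1)$, and let $\{\eta_t\}_{t\ge 1}$ be a sequence of positive step sizes. Let $\mathcal{C}=\{\mathbf{A}\in\mathbb{R}^{m\times n}:\|\mathbf{A}\|_2\le\frac1\lambda\}$, where $\|\cdot\|_2$ is the spectral norm, let $\langle\cdot,\cdot\rangle$ be the Frobenius inner product on $\mathbb{R}^{m\times n}$, and let $\mathbf{X}_1\in\mathcal{C}$. Then the Muon algorithm (with weight decay) with parameters $\mu,\lambda,\{\eta_t\}$ is an instance of the stochastic Frank-Wolfe algorithm (SFW) over $\mathcal{C}$ with parameters $$\beta_{1,t}=\mu,\qquad \gamma_t=1-\mu,\qquad \eta_t^{\mathrm{SFW}}=\lambda\,\eta_t\qquad\text{for all } t\ge1.$$ That is, for every sequence of samples $\Xi_1,\Xi_2,\dots$, any sequence of iterates $(\mathbf{X}_t)_{t\ge1}$ produced by Muon from $\mathbf{X}_1$ coincides with a sequence of iterates produced by SFW with these parameters from the same initial point and the same samples (for an admissible choice of the minimizers $\mathbf{u}_t$ whenever the minimizer is not unique).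
   Context: $\nabla f(\mathbf{X};\Xi)\in\mathbb{R}^{m\times n}$ denotes the stochastic gradient at $\mathbf{X}$ computed from the sample (or mini-batch) $\Xi$; for the purposes of this statement it is an arbitrary function of $(\mathbf{X},\Xi)$. $\mathcal{O}_{m\times n}=\{\mathbf{A}\in\mathbb{R}^{m\times n}:\mathbf{A}^\top\mathbf{A}=\mathbf{I}_n\text{ or }\mathbf{A}\mathbf{A}^\top=\mathbf{I}_m\}$ is the set of semi-orthogonal matrices and $\|\cdot\|_F$ is the Frobenius norm. Muon algorithm: parameters $\mu$, step sizes $\{\eta_t\}$, weight decay $\lambda$. Initialize $\mathbf{B}_0=0$ and $\mathbf{X}_1\in\mathcal{C}$. For $t=1,2,\dots$: sample $\Xi_t$; compute $\mathbf{G}_t=\nabla f(\mathbf{X}_t;\Xi_t)$; set $\mathbf{B}_t=\mu\mathbf{B}_{t-1}+\mathbf{G}_t$; choose $\mathbf{O}_t\in\arg\min_{\mathbf{A}\in\mathcal{O}_{m\times n}}\|\mathbf{A}-\mathbf{B}_t\|_F$; set $\mathbf{X}_{t+1}=\mathbf{X}_t-\eta_t(\mathbf{O}_t+\lambda\mathbf{X}_t)$. Stochastic Frank-Wolfe algorithm (SFW) over a convex compact set $\mathcal{C}$: parameters $\{\beta_{1,t}\},\{\gamma_t\}$, step sizes $\{\eta_t^{\mathrm{SFW}}\}$. Initialize $\mathbf{g}_0=0$ and $\mathbf{x}_1\in\mathcal{C}$. For $t=1,2,\dots$: sample $\Xi_t$; compute $\bar{\mathbf{g}}_t=\nabla f(\mathbf{x}_t;\Xi_t)$;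 set $\mathbf{g}_t=(1-\gamma_t)\mathbf{g}_{t-1}+\gamma_t\bar{\mathbf{g}}_t$; set $\hat{\mathbf{g}}_t=\frac{\beta_{1,t}}{1-\gamma_t}\mathbf{g}_t+\left(1-\frac{\beta_{1,t}}{1-\gamma_t}\right)\bar{\mathbf{g}}_t$; choose $\mathbf{u}_t\in\arg\min_{\mathbf{v}\in\mathcal{C}}\langle\mathbf{v},\hat{\mathbf{g}}_t\rangle$; set $\mathbf{x}_{t+1}=(1-\eta_t^{\mathrm{SFW}})\mathbf{x}_t+\eta_t^{\mathrm{SFW}}\mathbf{u}_t$. *)

theory Defs
  imports "HOL-Analysis.Analysis"
begin

text \<open>
  The norm and inner product of the type \<^typ>\<open>real^'n^'m\<close> are the Frobenius ones.
\<close>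

lemma inner_matrix_eq_frobenius:
  fixes A B :: "real^'n^'m"
  shows "A \<bullet> B = (\<Sum>i\<in>UNIV. \<Sum>j\<in>UNIV. A $ i $ j * B $ i $ j)"
  by (simp add: inner_vec_def)

lemma norm_matrix_eq_frobenius:
  fixes A :: "real^'n^'m"
  shows "norm A = sqrt (\<Sum>i\<in>UNIV. \<Sum>j\<in>UNIV. (A $ i $ j)\<^sup>2)"
  by (simp add: norm_eq_sqrt_inner inner_vec_def power2_eq_square)

definition spectral_norm :: "real^'n^'m \<Rightarrow> real" where
  "spectral_norm A = onorm (\<lambda>x. A *v x)"

definition spectral_ball :: "real \<Rightarrow> (real^'n^'m) set" where
  "spectral_ball r = {A. spectral_norm A \<le> r}"

definition semi_orthogonal :: "(real^'n^'m) set" where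
  "semi_orthogonal = {A. transpose A ** A = mat 1 \<or> A ** transpose A = mat 1}"

text \<open>
  Both algorithms are rendered as predicates on the sequence of iterates, because the minimizers
  need not be unique. The iterates are indexed from 1; the value at index 0 is left unconstrained.
\<close>

definition muon_iterates ::
  "(real^'n^'m) set \<Rightarrow> (real^'n^'m \<Rightarrow> 's \<Rightarrow> real^'n^'m) \<Rightarrow> real \<Rightarrow> real \<Rightarrow> (nat \<Rightarrow> real) \<Rightarrow>
    (nat \<Rightarrow> 's) \<Rightarrow> real^'n^'m \<Rightarrow> (nat \<Rightarrow> real^'n^'m) \<Rightarrow> bool" where
  "muon_iterates C grad \<mu> lam \<eta> \<Xi> X1 X \<longleftrightarrow>
     X1 \<in> C \<and> X 1 = X1 \<and>
     (\<exists>G B Q. B 0 = 0 \<and>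
        (\<forall>t\<ge>1.
           G t = grad (X t) (\<Xi> t) \<and>
           B t = \<mu> *\<^sub>R B (t - 1) + G t \<and>
           is_arg_min (\<lambda>A. norm (A - B t)) (\<lambda>A. A \<in> semi_orthogonal) (Q t) \<and>
           X (t + 1) = X t - \<eta> t *\<^sub>R (Q t + lam *\<^sub>R X t)))"

definition sfw_iterates ::
  "(real^'n^'m) set \<Rightarrow> (real^'n^'m \<Rightarrow> 's \<Rightarrow> real^'n^'m) \<Rightarrow> (nat \<Rightarrow> real) \<Rightarrow> (nat \<Rightarrow> real) \<Rightarrow>
    (nat \<Rightarrow> real) \<Rightarrow> (nat \<Rightarrow> 's) \<Rightarrow> real^'n^'m \<Rightarrow> (nat \<Rightarrow> real^'n^'m) \<Rightarrow> bool" where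
  "sfw_iterates C grad \<beta> \<gamma> \<eta> \<Xi> x1 x \<longleftrightarrow>
     convex C \<and> compact C \<and> x1 \<in> C \<and> x 1 = x1 \<and>
     (\<exists>gbar g ghat u. g 0 = 0 \<and>
        (\<forall>t\<ge>1.
           gbar t = grad (x t) (\<Xi> t) \<and>
           g t = (1 - \<gamma> t) *\<^sub>R g (t - 1) + \<gamma> t *\<^sub>R gbar t \<and>
           ghat t = (\<beta> t / (1 - \<gamma> t)) *\<^sub>R g t + (1 - \<beta> t / (1 - \<gamma> t)) *\<^sub>R gbar t \<and>
           is_arg_min (\<lambda>v. v \<bullet> ghat t) (\<lambda>v. v \<in> C) (u t) \<and>
           x (t + 1) = (1 - \<eta> t) *\<^sub>R x t + \<eta> t *\<^sub>R u t))"

end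

theory Submission
  imports Defs
begin

text \<open>
  Write the Muon direction as \<open>Q\<close>, a semi-orthogonal matrix nearest to the momentum \<open>B\<close>. The
  two momentum recursions differ by a constant factor: the averaged gradient of Frank-Wolfe is
  \<open>(1 - \<mu>) B\<close>, and as \<open>\<beta> = 1 - \<gamma> = \<mu>\<close> the extrapolated gradient equals it. The two
  position updates agree when the Frank-Wolfe vertex is \<open>- Q / lam\<close>. What has to be shown is that
  this matrix minimizes the inner product with \<open>B\<close> over the spectral ball of radius \<open>1 / lam\<close>;
  after scaling and a change of sign, that \<open>Q\<close> maximizes the inner product with \<open>B\<close> over the unit
  spectral ball.

  All semi-orthogonal matrices of one shape have the same Frobenius norm, so being nearest to \<open>B\<close>
  among them is the same as having the largest inner product with \<open>B\<close> among them
  (lemma \<open>nearest_semi_orthogonal_maximizes_inner\<close>). To pass from the semi-orthogonal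
  matrices to the ball it suffices that the ball is contained in their convex hull, since a linear
  functional bounded on a set is bounded on its hull. By the Krein-Milman-Minkowski theorem this
  reduces to showing that the extreme points of the unit spectral ball are semi-orthogonal
  (lemma \<open>extreme_point_spectral_ball_semi_orthogonal\<close>).

  For the latter, a contraction \<open>A\<close> that is not semi-orthogonal has a pair of unit singular
  vectors \<open>x\<close>, \<open>y\<close> with singular value \<open>s < 1\<close>
  (lemma \<open>contraction_singular_pair_less_1\<close>). Moving \<open>A\<close> by \<open>1 - s\<close> in either
  direction along the rank-one matrix \<open>y x\<^sup>T\<close> changes only that singular value, to \<open>1\<close> or
  to \<open>2 s - 1\<close>, so both results are contractions, and \<open>A\<close> is their midpoint. The singular
  pair itself comes from minimizing \<open>norm (A x)\<close> over the unit sphere.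
\<close>

section \<open>The spectral ball\<close>

lemma mem_spectral_ball_iff:
  fixes A :: "real^'n^'m"
  shows "A \<in> spectral_ball r \<longleftrightarrow> (\<forall>x. norm (A *v x) \<le> r * norm x)"
proof
  assume "A \<in> spectral_ball r"
  then have r: "onorm ((*v) A) \<le> r"
    by (simp add: spectral_ball_def spectral_norm_def)
  show "\<forall>x. norm (A *v x) \<le> r * norm x"
  proof
    fix x
    have "norm (A *v x) \<le> onorm ((*v) A) * norm x"
      by (rule onorm) simp
    also have "\<dots> \<le> r * norm x"
      using r by (rule mult_right_mono) simp
    finally show "norm (A *v x) \<le> r * norm x" .
  qed
next
  assume "\<forall>x. norm (A *v x) \<le> r * norm x"
  then show "A \<in> spectral_ball r"
    by (auto simp: spectral_ball_def spectral_norm_def intro: onorm_le)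
qed

lemma scaleR_mem_spectral_ball:
  fixes A :: "real^'n^'m"
  assumes "A \<in> spectral_ball r"
  shows "c *\<^sub>R A \<in> spectral_ball (\<bar>c\<bar> * r)"
  using assms
  by (auto simp: mem_spectral_ball_iff scaleR_matrix_vector_assoc[symmetric] mult.assoc
      intro: mult_left_mono)

lemma convex_spectral_ball: "convex (spectral_ball r :: (real^'n^'m) set)"
proof (rule convexI)
  fix A B :: "real^'n^'m" and u v :: real
  assume AB: "A \<in> spectral_ball r" "B \<in> spectral_ball r" and uv: "0 \<le> u" "0 \<le> v" "u + v = 1"
  show "u *\<^sub>R A + v *\<^sub>R B \<in> spectral_ball r"
    unfolding mem_spectral_ball_iff
  proof
    fix x
    have "norm ((u *\<^sub>R A + v *\<^sub>R B) *v x) \<le> u * norm (A *v x) + v * norm (B *v x)"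
      using uv norm_triangle_ineq[of "u *\<^sub>R (A *v x)" "v *\<^sub>R (B *v x)"]
      by (simp add: matrix_vector_mult_add_rdistrib scaleR_matrix_vector_assoc[symmetric])
    also have "\<dots> \<le> u * (r * norm x) + v * (r * norm x)"
      using AB uv by (intro add_mono mult_left_mono) (auto simp: mem_spectral_ball_iff)
    also have "\<dots> = r * norm x"
      using uv by (metis distrib_right mult_1)
    finally show "norm ((u *\<^sub>R A + v *\<^sub>R B) *v x) \<le> r * norm x" .
  qed
qed

lemma compact_spectral_ball: "compact (spectral_ball r :: (real^'n^'m) set)"
  unfolding compact_eq_bounded_closed
proof
  have "norm A \<le> (\<Sum>i\<in>(UNIV::'m set). \<Sum>j\<in>(UNIV::'n set). r)"
    if A: "A \<in> spectral_ball r" for A :: "real^'n^'m"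
  proof -
    have "\<bar>A $ i $ j\<bar> \<le> r" for i j
    proof -
      have "\<bar>A $ i $ j\<bar> = \<bar>(A *v axis j 1) $ i\<bar>"
        by (simp add: matrix_vector_mult_basis column_def)
      also have "\<dots> \<le> norm (A *v axis j 1)"
        by (rule component_le_norm_cart)
      also have "\<dots> \<le> r * norm (axis j 1 :: real^'n)"
        using A by (simp only: mem_spectral_ball_iff)
      finally show ?thesis
        by simp
    qed
    then have "norm (A $ i) \<le> (\<Sum>j\<in>(UNIV::'n set). r)" for i
      by (intro order_trans[OF norm_le_l1_cart] sum_mono) auto
    then have "(\<Sum>i\<in>UNIV. norm (A $ i)) \<le> (\<Sum>i\<in>(UNIV::'m set). \<Sum>j\<in>(UNIV::'n set). r)"
      by (rule sum_mono)
    moreover have "norm A \<le> (\<Sum>i\<in>UNIV. norm (A $ i))"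
      unfolding norm_vec_def by (rule L2_set_le_sum) simp
    ultimately show ?thesis
      by (rule order_trans[rotated])
  qed
  then show "bounded (spectral_ball r :: (real^'n^'m) set)"
    unfolding bounded_iff by blast
next
  have lin: "linear (\<lambda>A :: real^'n^'m. A *v x)" for x
    by (rule linearI) (simp_all add: matrix_vector_mult_add_rdistrib scaleR_matrix_vector_assoc)
  then have "continuous_on UNIV (\<lambda>A :: real^'n^'m. A *v x)" for x
    by (simp add: linear_continuous_on linear_conv_bounded_linear)
  then have "closed {A :: real^'n^'m. \<forall>x. norm (A *v x) \<le> r * norm x}"
    by (intro closed_Collect_all closed_Collect_le continuous_on_norm continuous_on_const)
  then show "closed (spectral_ball r :: (real^'n^'m) set)"
    by (simp add: mem_spectral_ball_iff[symmetric])
qed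

section \<open>Singular vectors\<close>

lemma inner_transpose_mult:
  fixes A :: "real^'n^'m"
  shows "(transpose A *v y) \<bullet> x = y \<bullet> (A *v x)"
  by (simp add: dot_lmul_matrix)

text \<open>
  With \<open>w = A\<^sup>T y\<close>, the bound comes from \<open>|w|\<^sup>2 = y \<bullet> A w \<le> |y| r |w|\<close>.
\<close>

lemma transpose_mem_spectral_ball:
  fixes A :: "real^'n^'m"
  assumes A: "A \<in> spectral_ball r"
  shows "transpose A \<in> spectral_ball r"
  unfolding mem_spectral_ball_iff
proof
  fix y
  let ?w = "transpose A *v y"
  have "norm ?w * norm ?w = y \<bullet> (A *v ?w)"
    by (metis inner_transpose_mult power2_norm_eq_inner power2_eq_square)
  also have "\<dots> \<le> norm y * norm (A *v ?w)"
    by (rule norm_cauchy_schwarz)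
  also have "\<dots> \<le> norm y * (r * norm ?w)"
    using A by (intro mult_left_mono) (auto simp only: mem_spectral_ball_iff norm_ge_zero)
  finally have "norm ?w * norm ?w \<le> (r * norm y) * norm ?w"
    by (simp add: mult_ac)
  moreover have "0 \<le> r * norm y"
  proof -
    have "norm (A *v axis undefined 1) \<le> r"
      using A by (metis mem_spectral_ball_iff mult.right_neutral norm_axis_1)
    then have "0 \<le> r"
      using norm_ge_zero order_trans by blast
    then show ?thesis
      by simp
  qed
  ultimately show "norm ?w \<le> r * norm y"
    by (cases "norm ?w = 0") (auto simp del: transpose_matrix_vector dest: mult_right_le_imp_le)
qed

text \<open>
  At a minimizer of the Rayleigh quotient of \<open>A\<^sup>T A\<close> the first variation
  vanishes, which is the eigenvector equation. The linear term of the nonnegative quadratic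
  \<open>t \<mapsto> |A (x + t v)|\<^sup>2 - |A x|\<^sup>2 |x + t v|\<^sup>2\<close> is tested only along the
  residual \<open>v\<close> itself, where its coefficient is \<open>2 |v|\<^sup>2\<close>.
\<close>

lemma minimizer_gram_eigenvector:
  fixes A :: "real^'n^'m"
  assumes x: "norm x = 1" and min: "\<And>z. norm (A *v x) * norm z \<le> norm (A *v z)"
  shows "transpose A *v (A *v x) = (norm (A *v x))\<^sup>2 *\<^sub>R x"
proof -
  define s where "s = (norm (A *v x))\<^sup>2"
  define v where "v = transpose A *v (A *v x) - s *\<^sub>R x"
  define b where "b = v \<bullet> v"
  define c where "c = (A *v v) \<bullet> (A *v v) - s * (v \<bullet> v)"
  have quad: "s * (z \<bullet> z) \<le> (A *v z) \<bullet> (A *v z)" for z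
    using power_mono[OF min[of z], of 2]
    by (simp add: s_def power_mult_distrib power2_norm_eq_inner)
  have xx: "x \<bullet> x = 1"
    using x by (simp add: norm_eq_1)
  have cross: "(A *v x) \<bullet> (A *v v) - s * (x \<bullet> v) = b"
    by (simp add: b_def v_def inner_transpose_mult[symmetric] inner_diff_left
        del: transpose_matrix_vector)
  have nonneg: "0 \<le> 2 * t * b + t\<^sup>2 * c" for t
  proof -
    have "(A *v (x + t *\<^sub>R v)) \<bullet> (A *v (x + t *\<^sub>R v)) - s * ((x + t *\<^sub>R v) \<bullet> (x + t *\<^sub>R v))
        = ((A *v x) \<bullet> (A *v x) - s * (x \<bullet> x))
          + 2 * t * ((A *v x) \<bullet> (A *v v) - s * (x \<bullet> v)) + t\<^sup>2 * c"
      by (simp add: c_def matrix_vector_right_distrib matrix_vector_mult_scaleR inner_add_left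
          inner_add_right inner_commute[of v x] inner_commute[of "A *v v" "A *v x"]
          power2_eq_square algebra_simps)
    moreover have "(A *v x) \<bullet> (A *v x) - s * (x \<bullet> x) = 0"
      using xx by (simp add: s_def power2_norm_eq_inner)
    ultimately show ?thesis
      using quad[of "x + t *\<^sub>R v"] cross by simp
  qed
  have c: "0 \<le> c"
    using quad[of v] by (simp add: c_def)
  have "b = 0"
  proof (rule ccontr)
    assume "b \<noteq> 0"
    define r where "r = b / (c + 1)"
    have br: "b = r * (c + 1)"
      using c by (simp add: r_def)
    \<comment> \<open>At \<open>t = - b / (c + 1)\<close> the quadratic has the value \<open>- b\<^sup>2 (c + 2) / (c + 1)\<^sup>2\<close>.\<close>
    have "2 * (- r) * b + (- r)\<^sup>2 * c = - (r\<^sup>2 * (c + 2))"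
      unfolding br by (simp add: power2_eq_square algebra_simps)
    moreover have "0 < r\<^sup>2 * (c + 2)"
      using \<open>b \<noteq> 0\<close> br c by (intro mult_pos_pos) auto
    ultimately show False
      using nonneg[of "- r"] by linarith
  qed
  then show ?thesis
    by (simp add: b_def v_def s_def)
qed

text \<open>
  If the smallest singular value of a contraction were \<open>1\<close>, every unit vector would be a
  minimizer and hence fixed by \<open>A\<^sup>T A\<close>.
\<close>

lemma contraction_gram_eigenvector_less_1:
  fixes A :: "real^'n^'m"
  assumes A: "A \<in> spectral_ball 1" and not_isometry: "transpose A ** A \<noteq> mat 1"
  obtains x where "norm x = 1" "norm (A *v x) < 1"
    "transpose A *v (A *v x) = (norm (A *v x))\<^sup>2 *\<^sub>R x"
proof -
  have contr: "norm (A *v z) \<le> norm z" for z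
    using A by (simp add: mem_spectral_ball_iff)
  have "(axis undefined 1 :: real^'n) \<in> sphere 0 1"
    by simp
  then have "sphere (0 :: real^'n) 1 \<noteq> {}"
    by blast
  moreover have "continuous_on (sphere 0 1) (\<lambda>z. norm (A *v z))"
    by (intro continuous_on_norm matrix_vector_mult_linear_continuous_on)
  ultimately obtain x where x: "x \<in> sphere 0 1" and
    inf: "\<And>z. z \<in> sphere 0 1 \<Longrightarrow> norm (A *v x) \<le> norm (A *v z)"
    using continuous_attains_inf[OF compact_sphere] by blast
  have min: "norm (A *v x) * norm z \<le> norm (A *v z)" for z
  proof (cases "z = 0")
    case False
    have "norm (A *v x) \<le> norm (A *v ((1 / norm z) *\<^sub>R z))"
      using False by (intro inf) simp
    then show ?thesis
      using False by (simp add: matrix_vector_mult_scaleR field_simps)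
  qed simp
  have nx: "norm x = 1"
    using x by simp
  have "norm (A *v x) < 1"
  proof (rule ccontr)
    assume "\<not> norm (A *v x) < 1"
    then have iso: "norm (A *v z) = norm z" for z
      using min[of z] contr[of z] contr[of x] nx by simp
    have unit: "transpose A *v (A *v z) = z" if "norm z = 1" for z
      using minimizer_gram_eigenvector[OF that, of A] that by (simp add: iso)
    have "transpose A *v (A *v z) = z" for z
    proof (cases "z = 0")
      case False
      then have "transpose A *v (A *v ((1 / norm z) *\<^sub>R z)) = (1 / norm z) *\<^sub>R z"
        by (intro unit) simp
      then show ?thesis
        using False by (simp add: matrix_vector_mult_scaleR del: transpose_matrix_vector)
    qed simp
    then have "transpose A ** A = mat 1"
      by (simp add: matrix_eq matrix_vector_mul_assoc[symmetric] del: transpose_matrix_vector)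
    with not_isometry show False ..
  qed
  with that nx min show ?thesis
    using minimizer_gram_eigenvector by blast
qed

text \<open>
  A right singular vector \<open>x\<close> with nonzero singular value determines its left partner
  \<open>A x / |A x|\<close>, and vice versa. If the singular values found for \<open>A\<close> and for its transpose
  both vanish, neither vector determines a partner; then the two vectors found, one in the kernel
  of \<open>A\<close> and one in that of the transpose, form a pair with singular value \<open>0\<close>.
\<close>

lemma contraction_singular_pair_less_1:
  fixes A :: "real^'n^'m"
  assumes A: "A \<in> spectral_ball 1" and not_so: "A \<notin> semi_orthogonal"
  obtains x y s where "norm x = 1" "norm y = 1" "0 \<le> s" "s < 1"
    "A *v x = s *\<^sub>R y" "transpose A *v y = s *\<^sub>R x"
proof -
  obtain x where x: "norm x = 1" "norm (A *v x) < 1"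
    "transpose A *v (A *v x) = (norm (A *v x))\<^sup>2 *\<^sub>R x"
    using contraction_gram_eigenvector_less_1[OF A] not_so by (auto simp: semi_orthogonal_def)
  have "transpose (transpose A) ** transpose A \<noteq> mat 1"
    using not_so by (auto simp: semi_orthogonal_def)
  with contraction_gram_eigenvector_less_1[OF transpose_mem_spectral_ball[OF A]]
  obtain y where y: "norm y = 1" "norm (transpose A *v y) < 1"
    "A *v (transpose A *v y) = (norm (transpose A *v y))\<^sup>2 *\<^sub>R y"
    by (metis transpose_transpose)
  consider "A *v x \<noteq> 0" | "transpose A *v y \<noteq> 0" | "A *v x = 0" "transpose A *v y = 0"
    by blast
  then show ?thesis
  proof cases
    case 1
    then show ?thesis
      using x by (intro that[of x "(1 / norm (A *v x)) *\<^sub>R (A *v x)" "norm (A *v x)"])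
        (simp_all add: matrix_vector_mult_scaleR power2_eq_square del: transpose_matrix_vector)
  next
    case 2
    then show ?thesis
      using y by (intro that[of "(1 / norm (transpose A *v y)) *\<^sub>R (transpose A *v y)" y
            "norm (transpose A *v y)"])
        (simp_all add: matrix_vector_mult_scaleR power2_eq_square del: transpose_matrix_vector)
  next
    case 3
    then show ?thesis
      using x y by (intro that[of x y 0]) simp_all
  qed
qed

section \<open>Extreme points of the spectral ball\<close>

definition outer_product :: "real^'m \<Rightarrow> real^'n \<Rightarrow> real^'n^'m" where
  "outer_product y x = (\<chi> i j. y $ i * x $ j)"

lemma outer_product_mult_vec: "outer_product y x *v z = (x \<bullet> z) *\<^sub>R y"
  by (simp add: vec_eq_iff outer_product_def matrix_vector_mult_def inner_vec_def
      sum_distrib_right sum_distrib_left mult_ac)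

text \<open>
  Split a vector as \<open>a x + w\<close> with \<open>w\<close> orthogonal to \<open>x\<close>. The image of \<open>w\<close> under \<open>A\<close> is
  orthogonal to \<open>y\<close>, so the perturbed matrix acts on the two summands independently, and
  only the factor on the first one, \<open>s + d\<close>, has changed.
\<close>

lemma perturb_singular_value_mem_spectral_ball:
  fixes A :: "real^'n^'m"
  assumes A: "A \<in> spectral_ball 1" and x: "norm x = 1" and y: "norm y = 1"
    and Ax: "A *v x = s *\<^sub>R y" and Ay: "transpose A *v y = s *\<^sub>R x" and d: "\<bar>s + d\<bar> \<le> 1"
  shows "A + d *\<^sub>R outer_product y x \<in> spectral_ball 1"
  unfolding mem_spectral_ball_iff
proof
  fix z
  define a where "a = x \<bullet> z"
  define w where "w = z - a *\<^sub>R x"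
  have z: "z = a *\<^sub>R x + w"
    by (simp add: w_def)
  have xw: "x \<bullet> w = 0"
    using x by (simp add: w_def a_def inner_diff_right norm_eq_1)
  have yw: "y \<bullet> (A *v w) = 0"
    using xw Ay inner_transpose_mult[of A y w] by simp
  have image: "(A + d *\<^sub>R outer_product y x) *v z = (a * (s + d)) *\<^sub>R y + A *v w"
  proof -
    have "(A + d *\<^sub>R outer_product y x) *v z = A *v z + (d * a) *\<^sub>R y"
      by (simp add: matrix_vector_mult_add_rdistrib scaleR_matrix_vector_assoc[symmetric]
          outer_product_mult_vec a_def)
    also have "A *v z = (a * s) *\<^sub>R y + A *v w"
      by (subst z) (simp add: matrix_vector_right_distrib matrix_vector_mult_scaleR Ax)
    finally show ?thesis
      by (simp add: algebra_simps)
  qed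
  have "(norm ((A + d *\<^sub>R outer_product y x) *v z))\<^sup>2 = a\<^sup>2 * (s + d)\<^sup>2 + (norm (A *v w))\<^sup>2"
    unfolding image using yw y
    by (subst norm_add_Pythagorean) (simp_all add: orthogonal_def power_mult_distrib)
  also have "\<dots> \<le> a\<^sup>2 * 1 + (norm w)\<^sup>2"
    using d A by (intro add_mono mult_left_mono power_mono)
      (simp_all add: abs_square_le_1 mem_spectral_ball_iff)
  also have "\<dots> = (norm z)\<^sup>2"
    using xw x by (subst z, subst norm_add_Pythagorean)
      (simp_all add: orthogonal_def)
  finally show "norm ((A + d *\<^sub>R outer_product y x) *v z) \<le> 1 * norm z"
    by (simp add: power2_le_iff_abs_le)
qed

lemma extreme_point_spectral_ball_semi_orthogonal:
  fixes A :: "real^'n^'m"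
  assumes ext: "A extreme_point_of spectral_ball 1"
  shows "A \<in> semi_orthogonal"
proof (rule ccontr)
  assume "A \<notin> semi_orthogonal"
  moreover have A: "A \<in> spectral_ball 1"
    using ext by (simp add: extreme_point_of_def)
  ultimately obtain x y s where xy: "norm x = 1" "norm y = 1" and s: "0 \<le> s" "s < 1"
    and pair: "A *v x = s *\<^sub>R y" "transpose A *v y = s *\<^sub>R x"
    using contraction_singular_pair_less_1 by blast
  define E where "E = (1 - s) *\<^sub>R outer_product y x"
  have "A + E \<in> spectral_ball 1"
    unfolding E_def using s
    by (intro perturb_singular_value_mem_spectral_ball[OF A xy pair]) simp
  moreover have "A - E \<in> spectral_ball 1"
    using perturb_singular_value_mem_spectral_ball[OF A xy pair, of "- (1 - s)"] s
    unfolding E_def scaleR_minus_left by simp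
  moreover have "A \<in> open_segment (A - E) (A + E)"
  proof -
    have "E *v x = (1 - s) *\<^sub>R y"
      using xy by (simp add: E_def scaleR_matrix_vector_assoc[symmetric] outer_product_mult_vec
          norm_eq_1)
    moreover have "y \<noteq> 0"
      using xy by auto
    ultimately have "E \<noteq> 0"
      using s by auto
    then have "2 *\<^sub>R E \<noteq> 0"
      by simp
    then have "A - E \<noteq> A + E"
      by (simp add: scaleR_2 algebra_simps)
    moreover have "midpoint (A - E) (A + E) = A"
      by (simp add: midpoint_def scaleR_2[symmetric])
    ultimately show ?thesis
      by (metis midpoint_in_open_segment)
  qed
  ultimately show False
    using ext by (auto simp: extreme_point_of_def)
qed

lemma spectral_ball_subset_hull_semi_orthogonal:
  "spectral_ball 1 \<subseteq> convex hull (semi_orthogonal :: (real^'n^'m) set)"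
proof -
  have "spectral_ball 1 = convex hull {A :: real^'n^'m. A extreme_point_of spectral_ball 1}"
    by (rule Krein_Milman_Minkowski[OF compact_spectral_ball convex_spectral_ball])
  also have "\<dots> \<subseteq> convex hull semi_orthogonal"
    by (intro hull_mono) (auto intro: extreme_point_spectral_ball_semi_orthogonal)
  finally show ?thesis .
qed

section \<open>Semi-orthogonal matrices\<close>

lemma semi_orthogonal_subset_spectral_ball:
  "(semi_orthogonal :: (real^'n^'m) set) \<subseteq> spectral_ball 1"
proof -
  have isometry: "A \<in> spectral_ball 1" if "transpose A ** A = mat 1" for A :: "real^'p^'q"
    unfolding mem_spectral_ball_iff
  proof
    fix x
    have "(A *v x) \<bullet> (A *v x) = x \<bullet> x"
      by (metis inner_transpose_mult matrix_vector_mul_assoc matrix_vector_mul_lid that)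
    then show "norm (A *v x) \<le> 1 * norm x"
      by (simp add: norm_eq_sqrt_inner)
  qed
  show ?thesis
  proof
    fix A :: "real^'n^'m"
    assume "A \<in> semi_orthogonal"
    then consider "transpose A ** A = mat 1" | "transpose (transpose A) ** transpose A = mat 1"
      by (auto simp: semi_orthogonal_def)
    then show "A \<in> spectral_ball 1"
    proof cases
      case 2
      then show ?thesis
        using transpose_mem_spectral_ball[OF isometry] by (metis transpose_transpose)
    qed (rule isometry)
  qed
qed

lemma inner_transpose_transpose:
  fixes A B :: "real^'n^'m"
  shows "transpose A \<bullet> transpose B = A \<bullet> B"
  unfolding inner_matrix_eq_frobenius by (subst sum.swap) (simp add: transpose_def)

lemma isometry_inner_self:
  fixes A :: "real^'n^'m"
  assumes "transpose A ** A = mat 1"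
  shows "A \<bullet> A = CARD('n)"
proof -
  have "(\<Sum>i\<in>UNIV. A $ i $ j * A $ i $ j) = 1" for j
  proof -
    have "(transpose A ** A) $ j $ j = 1"
      by (simp add: assms mat_def)
    then show ?thesis
      by (simp add: matrix_matrix_mult_def transpose_def)
  qed
  moreover have "A \<bullet> A = (\<Sum>j\<in>UNIV. \<Sum>i\<in>UNIV. A $ i $ j * A $ i $ j)"
    unfolding inner_matrix_eq_frobenius by (rule sum.swap)
  ultimately show ?thesis
    by simp
qed

lemma isometry_card_le:
  fixes A :: "real^'n^'m"
  assumes "transpose A ** A = mat 1"
  shows "CARD('n) \<le> CARD('m)"
proof -
  have "inj ((*v) A)"
    using assms matrix_left_invertible_injective by blast
  then show ?thesis
    using rank_bound[of A] by (simp add: full_rank_injective[symmetric])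
qed

text \<open>
  The two kinds of semi-orthogonal matrices coexist only for square shapes, where the two values
  \<open>CARD('n)\<close> and \<open>CARD('m)\<close> agree.
\<close>

lemma semi_orthogonal_inner_self:
  fixes A :: "real^'n^'m"
  assumes "A \<in> semi_orthogonal"
  shows "A \<bullet> A = min CARD('m) CARD('n)"
proof -
  consider "transpose A ** A = mat 1" | "transpose (transpose A) ** transpose A = mat 1"
    using assms by (auto simp: semi_orthogonal_def)
  then show ?thesis
  proof cases
    case 1
    then show ?thesis
      using isometry_inner_self isometry_card_le by fastforce
  next
    case 2
    then show ?thesis
      using isometry_inner_self[OF 2] isometry_card_le[OF 2]
      by (simp add: inner_transpose_transpose)
  qed
qed

text \<open>
  The squared distance from \<open>B\<close> to \<open>A\<close> is \<open>|A|\<^sup>2 - 2 A \<bullet> B + |B|\<^sup>2\<close>,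
  where only the middle term varies over the semi-orthogonal matrices.
\<close>

lemma nearest_semi_orthogonal_maximizes_inner:
  fixes B Q :: "real^'n^'m"
  assumes Q: "is_arg_min (\<lambda>A. norm (A - B)) (\<lambda>A. A \<in> semi_orthogonal) Q"
    and A: "A \<in> semi_orthogonal"
  shows "A \<bullet> B \<le> Q \<bullet> B"
proof -
  have Qso: "Q \<in> semi_orthogonal"
    using Q by (simp add: is_arg_min_def)
  have "norm (Q - B) \<le> norm (A - B)"
    using Q A by (auto simp: is_arg_min_linorder)
  then have "(Q - B) \<bullet> (Q - B) \<le> (A - B) \<bullet> (A - B)"
    by (simp add: norm_eq_sqrt_inner)
  then have "Q \<bullet> Q - 2 * (Q \<bullet> B) \<le> A \<bullet> A - 2 * (A \<bullet> B)"
    by (simp add: inner_diff_left inner_diff_right inner_commute)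
  then show ?thesis
    using semi_orthogonal_inner_self[OF Qso] semi_orthogonal_inner_self[OF A] by simp
qed

lemma nearest_semi_orthogonal_maximizes_inner_ball:
  fixes B Q :: "real^'n^'m"
  assumes Q: "is_arg_min (\<lambda>A. norm (A - B)) (\<lambda>A. A \<in> semi_orthogonal) Q"
    and A: "A \<in> spectral_ball 1"
  shows "A \<bullet> B \<le> Q \<bullet> B"
proof -
  have "semi_orthogonal \<subseteq> {A. B \<bullet> A \<le> B \<bullet> Q}"
    using nearest_semi_orthogonal_maximizes_inner[OF Q] by (auto simp: inner_commute)
  then have "convex hull semi_orthogonal \<subseteq> {A. B \<bullet> A \<le> B \<bullet> Q}"
    by (rule hull_minimal) (rule convex_halfspace_le)
  then show ?thesis
    using A spectral_ball_subset_hull_semi_orthogonal by (auto simp: inner_commute)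
qed

section \<open>Muon as Frank-Wolfe\<close>

text \<open>
  The factor \<open>c\<close> accounts for the averaged gradient of Frank-Wolfe being \<open>1 - \<mu>\<close> times
  the Muon momentum.
\<close>

lemma frank_wolfe_vertex_of_nearest_semi_orthogonal:
  fixes B Q :: "real^'n^'m"
  assumes Q: "is_arg_min (\<lambda>A. norm (A - B)) (\<lambda>A. A \<in> semi_orthogonal) Q"
    and lam: "0 < lam" and c: "0 \<le> c"
  shows "is_arg_min (\<lambda>v. v \<bullet> (c *\<^sub>R B)) (\<lambda>v. v \<in> spectral_ball (1 / lam)) (- (1 / lam) *\<^sub>R Q)"
proof -
  have "Q \<in> spectral_ball 1"
    using Q semi_orthogonal_subset_spectral_ball by (auto simp: is_arg_min_def)
  then have mem: "- (1 / lam) *\<^sub>R Q \<in> spectral_ball (1 / lam)"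
    using scaleR_mem_spectral_ball[of Q 1 "- (1 / lam)"] lam by simp
  have "(- (1 / lam) *\<^sub>R Q) \<bullet> (c *\<^sub>R B) \<le> v \<bullet> (c *\<^sub>R B)" if v: "v \<in> spectral_ball (1 / lam)" for v
  proof -
    have "(- lam) *\<^sub>R v \<in> spectral_ball 1"
      using scaleR_mem_spectral_ball[OF v, of "- lam"] lam by simp
    then have "((- lam) *\<^sub>R v) \<bullet> B \<le> Q \<bullet> B"
      by (rule nearest_semi_orthogonal_maximizes_inner_ball[OF Q])
    then have "- (Q \<bullet> B) / lam \<le> v \<bullet> B"
      using lam by (simp add: field_simps)
    from mult_left_mono[OF this c] show ?thesis
      by simp
  qed
  with mem show ?thesis
    by (simp add: is_arg_min_linorder)
qed

theorem theorem2:
  fixes grad :: "real^'n^'m \<Rightarrow> 's \<Rightarrow> real^'n^'m"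
    and \<mu> lam :: real and \<eta> :: "nat \<Rightarrow> real" and \<Xi> :: "nat \<Rightarrow> 's"
    and X1 :: "real^'n^'m" and X :: "nat \<Rightarrow> real^'n^'m"
  assumes "lam > 0" and "0 < \<mu>" and "\<mu> < 1"
    and "\<forall>t\<ge>1. \<eta> t > 0"
    and "X1 \<in> spectral_ball (1 / lam)"
    and "muon_iterates (spectral_ball (1 / lam)) grad \<mu> lam \<eta> \<Xi> X1 X"
  shows "sfw_iterates (spectral_ball (1 / lam)) grad
           (\<lambda>t. \<mu>) (\<lambda>t. 1 - \<mu>) (\<lambda>t. lam * \<eta> t) \<Xi> X1 X"
proof -
  obtain G B Q where X1: "X 1 = X1" and B0: "B 0 = 0"
    and G: "\<And>t. 1 \<le> t \<Longrightarrow> G t = grad (X t) (\<Xi> t)"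
    and B: "\<And>t. 1 \<le> t \<Longrightarrow> B t = \<mu> *\<^sub>R B (t - 1) + G t"
    and Q: "\<And>t. 1 \<le> t \<Longrightarrow>
      is_arg_min (\<lambda>A. norm (A - B t)) (\<lambda>A. A \<in> semi_orthogonal) (Q t)"
    and X: "\<And>t. 1 \<le> t \<Longrightarrow> X (t + 1) = X t - \<eta> t *\<^sub>R (Q t + lam *\<^sub>R X t)"
    using assms(6) unfolding muon_iterates_def by blast
  define g where "g t = (1 - \<mu>) *\<^sub>R B t" for t
  define u where "u t = - (1 / lam) *\<^sub>R Q t" for t
  have momentum: "g t = (1 - (1 - \<mu>)) *\<^sub>R g (t - 1) + (1 - \<mu>) *\<^sub>R G t" if "1 \<le> t" for t
    by (simp add: g_def B[OF that] scaleR_right_distrib mult.commute)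
  have extrapolation:
    "g t = (\<mu> / (1 - (1 - \<mu>))) *\<^sub>R g t + (1 - \<mu> / (1 - (1 - \<mu>))) *\<^sub>R G t" for t
    using assms(2) by simp
  have vertex: "is_arg_min (\<lambda>v. v \<bullet> g t) (\<lambda>v. v \<in> spectral_ball (1 / lam)) (u t)"
    if "1 \<le> t" for t
    unfolding g_def u_def using assms(1,3)
    by (intro frank_wolfe_vertex_of_nearest_semi_orthogonal Q that) auto
  have step: "X (t + 1) = (1 - lam * \<eta> t) *\<^sub>R X t + (lam * \<eta> t) *\<^sub>R u t" if "1 \<le> t" for t
    using assms(1) by (simp only: X[OF that] u_def) (simp add: algebra_simps)
  show ?thesis
    unfolding sfw_iterates_def
  proof (intro conjI exI allI impI)
    show "g 0 = 0"
      by (simp add: g_def B0)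
  qed (assumption | rule convex_spectral_ball compact_spectral_ball assms(5) X1
      G momentum extrapolation vertex step)+
qed

end
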